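(* There is a set of reals $X\subseteq\mathbb{R}$ (with the subspace topology) such that every finite power $X^k$ ($k\ge 1$) is Hurewicz, but $X$ is not productively Lindelöf (and hence $X$ is not Alster).
   Context: A topological space is productively Lindelöf if its product with every Lindelöf space is Lindelöf. A point-cofinite cover of a space is an infinite open cover such that each point belongs to all but finitely many members of the cover. A space $X$ is Hurewicz if for each sequence $\{\mathcal{U}_n\}_{n<\omega}$ of open covers of $X$ without finite subcovers there are finite $\mathcal{F}_n\subseteq\mathcal{U}_n$ such that $\{\bigcup\mathcal{F}_n : n<\omega\}$ is a point-cofinite cover of $X$. A space $X$ is Alster if every cover of $X$ by $G_\delta$ sets such that each compact subset of $X$ is included in some member of the cover has a countable subcover. *)

theory Defs
  imports "HOL-Analysis.Analysis"
begin

definition open_cover :: "'a topology \<Rightarrow> 'a set set \<Rightarrow> bool" where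
  "open_cover X \<U> \<longleftrightarrow> (\<forall>U\<in>\<U>. openin X U) \<and> \<Union>\<U> = topspace X"

definition point_cofinite_cover :: "'a topology \<Rightarrow> 'a set set \<Rightarrow> bool" where
  "point_cofinite_cover X \<U> \<longleftrightarrow> open_cover X \<U> \<and> infinite \<U> \<and>
     (\<forall>x\<in>topspace X. finite {U\<in>\<U>. x \<notin> U})"

definition Hurewicz_space :: "'a topology \<Rightarrow> bool" where
  "Hurewicz_space X \<longleftrightarrow>
     (\<forall>\<U> :: nat \<Rightarrow> 'a set set.
        (\<forall>n. open_cover X (\<U> n) \<and>
             \<not> (\<exists>\<F>. finite \<F> \<and> \<F> \<subseteq> \<U> n \<and> \<Union>\<F> = topspace X))
        \<longrightarrow> (\<exists>\<F> :: nat \<Rightarrow> 'a set set.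
               (\<forall>n. finite (\<F> n) \<and> \<F> n \<subseteq> \<U> n) \<and>
               point_cofinite_cover X (range (\<lambda>n. \<Union>(\<F> n)))))"

text \<open>Productively Lindelof: the product with every Lindelof space is Lindelof.
  Since HOL cannot quantify over types inside a formula, the other factor ranges
  over topologies on a fixed type, given by the itself-argument.\<close>
definition productively_Lindelof :: "'a topology \<Rightarrow> 'b itself \<Rightarrow> bool" where
  "productively_Lindelof X (T :: 'b itself) \<longleftrightarrow>
     (\<forall>Y :: 'b topology. Lindelof_space Y \<longrightarrow> Lindelof_space (prod_topology X Y))"

definition gdelta_in :: "'a topology \<Rightarrow> 'a set \<Rightarrow> bool" where
  "gdelta_in X G \<longleftrightarrow> G \<subseteq> topspace X \<and>
     (\<exists>\<O>. countable \<O> \<and> \<O> \<noteq> {} \<and> (\<forall>W\<in>\<O>. openin X W) \<and> G = \<Inter>\<O>)"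

definition Alster_space :: "'a topology \<Rightarrow> bool" where
  "Alster_space X \<longleftrightarrow>
     (\<forall>\<G>. (\<forall>G\<in>\<G>. gdelta_in X G) \<and> \<Union>\<G> = topspace X \<and>
           (\<forall>K. compactin X K \<longrightarrow> (\<exists>G\<in>\<G>. K \<subseteq> G))
        \<longrightarrow> (\<exists>\<V>. countable \<V> \<and> \<V> \<subseteq> \<G> \<and> \<Union>\<V> = topspace X))"

end

theory Submission
  imports Defs
begin

text \<open>
  Identify the Cantor set with the power set of the naturals. Let \<open>X\<close> consist of the finite sets
  together with a \<open>\<bb>\<close>-scale, i.e. infinite sets whose enumerations form an unbounded family that is
  well-ordered in type \<open>\<bb>\<close> by eventual domination. In a power of \<open>X\<close>, the tuples whose entries are all finite
  sets or late scale members are handled by one infinite set of indices on which the scale beats a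
  suitable function; the remaining tuples form a union of fewer than \<open>\<bb>\<close> copies of lower powers,
  and such unions preserve the Hurewicz property. Moreover \<open>X\<close> is uncountable but all its compact
  subsets are countable. Hence the real line with the points of \<open>X\<close> isolated is Lindelof, while
  its product with \<open>X\<close> contains the uncountable closed discrete diagonal of \<open>X\<close>; and the compact
  subsets of \<open>X\<close> form a \<open>G\<^sub>\<delta>\<close> cover without a countable subcover.
\<close>

unbundle cardinal_syntax

subsection \<open>Sets of reals with countable compact subsets\<close>

lemma gdelta_in_subtopology_if_closed:
  assumes "closed K" "K \<subseteq> X"
  shows "gdelta_in (subtopology euclideanreal X) K"
proof -
  have "closedin (subtopology euclideanreal X) K"
    using assms by (simp add: closedin_subset_topspace)
  then have "FSigma.gdelta_in (subtopology euclideanreal X) K"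
    using closed_imp_gdelta_in metrizable_space_subtopology metrizable_space_euclidean by blast
  then obtain C :: "nat \<Rightarrow> real set" where C: "\<And>n. openin (subtopology euclideanreal X) (C n)"
    "\<Inter>(range C) = K"
    unfolding gdelta_in_descending by auto
  then show ?thesis
    unfolding Defs.gdelta_in_def using assms
    by (intro conjI exI[of _ "range C"]) auto
qed

text \<open>
  The Michael line construction: the points of \<open>X\<close> are made isolated, the other points keep their
  Euclidean neighbourhoods.
\<close>
definition isolating_topology :: "real set \<Rightarrow> real topology" where
  "isolating_topology X = topology (\<lambda>S. \<exists>U D. open U \<and> D \<subseteq> X \<and> S = U \<union> D)"

lemma openin_isolating_topology:
  "openin (isolating_topology X) S \<longleftrightarrow> (\<exists>U D. open U \<and> D \<subseteq> X \<and> S = U \<union> D)"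
proof -
  have "istopology (\<lambda>S. \<exists>U D. open U \<and> D \<subseteq> X \<and> S = U \<union> D)"
    unfolding istopology_def
  proof (intro conjI allI impI)
    fix S T
    assume "\<exists>U D. open U \<and> D \<subseteq> X \<and> S = U \<union> D" "\<exists>U D. open U \<and> D \<subseteq> X \<and> T = U \<union> D"
    then obtain U D U' D' where "open U" "D \<subseteq> X" "S = U \<union> D" "open U'" "D' \<subseteq> X" "T = U' \<union> D'"
      by auto
    then show "\<exists>U D. open U \<and> D \<subseteq> X \<and> S \<inter> T = U \<union> D"
      by (intro exI[of _ "U \<inter> U'"] exI[of _ "(D \<inter> T) \<union> (D' \<inter> S)"]) auto
  next
    fix \<K>
    assume "\<forall>S\<in>\<K>. \<exists>U D. open U \<and> D \<subseteq> X \<and> S = U \<union> D"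
    then obtain u d where "\<And>S. S \<in> \<K> \<Longrightarrow> open (u S) \<and> d S \<subseteq> X \<and> S = u S \<union> d S"
      by metis
    then have "open (\<Union>(u ` \<K>))" "\<Union>(d ` \<K>) \<subseteq> X" "\<Union>\<K> = \<Union>(u ` \<K>) \<union> \<Union>(d ` \<K>)"
      by blast+
    then show "\<exists>U D. open U \<and> D \<subseteq> X \<and> \<Union>\<K> = U \<union> D"
      by blast
  qed
  then show ?thesis
    by (simp add: isolating_topology_def topology_inverse')
qed

lemma topspace_isolating_topology [simp]: "topspace (isolating_topology X) = UNIV"
proof -
  have "openin (isolating_topology X) UNIV"
    unfolding openin_isolating_topology by (intro exI[of _ UNIV] exI[of _ "{}"]) auto
  then show ?thesis
    using openin_subset by blast
qed

text \<open>The Euclidean interiors of the cover members miss only a closed set contained in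
  \<open>X\<close>, which is countable by assumption. Countably many interiors cover the rest since
  the real line is Lindelof.\<close>

lemma Lindelof_isolating_topology:
  assumes "\<And>C. closed C \<Longrightarrow> C \<subseteq> X \<Longrightarrow> countable C"
  shows "Lindelof_space (isolating_topology X)"
  unfolding Lindelof_space_def
proof (intro allI impI)
  fix \<U>
  assume U: "(\<forall>U\<in>\<U>. openin (isolating_topology X) U) \<and> \<Union>\<U> = topspace (isolating_topology X)"
  obtain \<W> where W: "\<W> \<subseteq> interior ` \<U>" "countable \<W>" "\<Union>\<W> = \<Union>(interior ` \<U>)"
    using Lindelof[of "interior ` \<U>"] by auto
  obtain \<V> where V: "\<V> \<subseteq> \<U>" "countable \<V>" "\<W> = interior ` \<V>"
    using W by (metis countable_subset_image)
  define C where "C = - \<Union>(interior ` \<U>)"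
  have "closed C"
    unfolding C_def by (intro closed_Compl open_Union) auto
  moreover have "C \<subseteq> X"
  proof
    fix x assume x: "x \<in> C"
    obtain T where T: "T \<in> \<U>" "x \<in> T"
      using U by (metis UNIV_I UnionE topspace_isolating_topology)
    then obtain O' D where "open O'" "D \<subseteq> X" "T = O' \<union> D"
      using U openin_isolating_topology by metis
    moreover have "x \<notin> O'"
      using x T calculation interior_maximal[of O' T] by (auto simp: C_def)
    ultimately show "x \<in> X"
      using T by auto
  qed
  ultimately have "countable C"
    using assms by blast
  obtain t where t: "\<And>x. t x \<in> \<U> \<and> x \<in> t x"
  proof -
    have "\<forall>x. \<exists>T. T \<in> \<U> \<and> x \<in> T"
      using U by (simp add: set_eq_iff) blast
    then show thesis
      using that by metis
  qed
  show "\<exists>\<V>. countable \<V> \<and> \<V> \<subseteq> \<U> \<and> \<Union>\<V> = topspace (isolating_topology X)"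
  proof (intro exI conjI)
    show "countable (\<V> \<union> t ` C)"
      using V \<open>countable C\<close> by auto
    show "\<V> \<union> t ` C \<subseteq> \<U>"
      using V t by auto
    have "x \<in> \<Union>(\<V> \<union> t ` C)" for x
    proof (cases "x \<in> C")
      case True
      then show ?thesis using t by auto
    next
      case False
      then have "x \<in> \<Union>(interior ` \<V>)"
        using W V by (auto simp: C_def)
      then show ?thesis
        using interior_subset by fastforce
    qed
    then show "\<Union>(\<V> \<union> t ` C) = topspace (isolating_topology X)"
      by auto
  qed
qed

text \<open>Cover the product by the complement \<open>Off\<close> of the diagonal and the strips
  \<open>X \<times> {x}\<close>. The point \<open>(x, x)\<close> lies in its own strip only, so a
  subcover must keep all of the uncountably many strips.\<close>

lemma not_productively_Lindelof:
  assumes "\<And>C. closed C \<Longrightarrow> C \<subseteq> X \<Longrightarrow> countable C" "uncountable X"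
  shows "\<not> productively_Lindelof (subtopology euclideanreal X) TYPE(real)"
proof
  let ?P = "prod_topology (subtopology euclideanreal X) (isolating_topology X)"
  assume "productively_Lindelof (subtopology euclideanreal X) TYPE(real)"
  then have L: "Lindelof_space ?P"
    unfolding productively_Lindelof_def using Lindelof_isolating_topology assms by blast
  define Off where "Off = {(x, y). x \<in> X \<and> x \<noteq> (y::real)}"
  define \<U> where "\<U> = insert Off ((\<lambda>x. X \<times> {x}) ` X)"
  have "openin ?P Off"
    unfolding openin_prod_topology_alt
  proof (intro allI impI)
    fix x y assume "(x, y) \<in> Off"
    then have xy: "x \<in> X" "x \<noteq> y" by (auto simp: Off_def)
    then obtain U V where UV: "open U" "open V" "x \<in> U" "y \<in> V" "U \<inter> V = {}"
      by (metis hausdorff)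
    then show "\<exists>U V. openin (subtopology euclideanreal X) U \<and> openin (isolating_topology X) V \<and>
         x \<in> U \<and> y \<in> V \<and> U \<times> V \<subseteq> Off"
      using xy by (intro exI[of _ "X \<inter> U"] exI[of _ V])
        (auto simp: Off_def openin_open openin_isolating_topology)
  qed
  moreover have "openin ?P (X \<times> {x})" if "x \<in> X" for x
  proof -
    have "openin (isolating_topology X) {x}"
      unfolding openin_isolating_topology using that by (intro exI[of _ "{}"] exI[of _ "{x}"]) auto
    then show ?thesis
      by (simp add: openin_prod_Times_iff)
  qed
  ultimately have "\<forall>U\<in>\<U>. openin ?P U"
    by (auto simp: \<U>_def)
  moreover have "\<Union>\<U> = topspace ?P"
    by (auto simp: \<U>_def Off_def)
  ultimately obtain \<V> where V: "countable \<V>" "\<V> \<subseteq> \<U>" "\<Union>\<V> = topspace ?P"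
    using L unfolding Lindelof_space_def by meson
  have "(\<lambda>x. X \<times> {x}) ` X \<subseteq> \<V>"
  proof clarify
    fix x assume x: "x \<in> X"
    then obtain T where T: "T \<in> \<V>" "(x, x) \<in> T"
    proof -
      have "(x, x) \<in> \<Union>\<V>"
        using V(3) x by simp
      then show thesis using that by blast
    qed
    have "(x, x) \<notin> Off"
      by (simp add: Off_def)
    then obtain z where "T = X \<times> {z}"
      using V(2) T unfolding \<U>_def by blast
    then have "T = X \<times> {x}"
      using T by simp
    then show "X \<times> {x} \<in> \<V>" using T by simp
  qed
  then have "countable ((\<lambda>x. X \<times> {x}) ` X)"
    using V countable_subset by blast
  moreover have "inj_on (\<lambda>x. X \<times> {x}) X"
    by (auto simp: inj_on_def)
  ultimately show False
    using assms(2) countable_image_inj_on by blast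
qed

text \<open>The compact subsets of \<open>X\<close> are themselves an admissible cover. They are
  countable, so countably many of them have a countable union.\<close>

lemma not_Alster_space:
  assumes "\<And>C. closed C \<Longrightarrow> C \<subseteq> X \<Longrightarrow> countable C" "uncountable X"
  shows "\<not> Alster_space (subtopology euclideanreal X)"
proof
  let ?\<G> = "{K. compact K \<and> K \<subseteq> X}"
  assume "Alster_space (subtopology euclideanreal X)"
  moreover have "\<forall>G\<in>?\<G>. gdelta_in (subtopology euclideanreal X) G"
    by (simp add: gdelta_in_subtopology_if_closed compact_imp_closed)
  moreover have "\<Union>?\<G> = topspace (subtopology euclideanreal X)"
  proof -
    have "x \<in> \<Union>?\<G>" if "x \<in> X" for x
      using that by (intro UnionI[of "{x}"]) auto
    then show ?thesis by auto
  qed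
  moreover have "\<forall>K. compactin (subtopology euclideanreal X) K \<longrightarrow> (\<exists>G\<in>?\<G>. K \<subseteq> G)"
    by (auto simp: compactin_subtopology)
  ultimately obtain \<V> where V: "countable \<V>" "\<V> \<subseteq> ?\<G>" "\<Union>\<V> = topspace (subtopology euclideanreal X)"
    unfolding Alster_space_def by meson
  have "countable (\<Union>\<V>)"
  proof -
    have "countable K" if "K \<in> \<V>" for K
      using V(2) that assms(1) compact_imp_closed by blast
    then show ?thesis
      using V(1) countable_UN[of \<V> "\<lambda>x. x"] by simp
  qed
  then show False
    using V assms(2) by simp
qed

subsection \<open>Uncountable G-delta sets\<close>

text \<open>As in the Cantor-Bendixson theorem, delete from \<open>G\<close> every open set that
  meets \<open>G\<close> in a countable set. By the Lindelof property countably many such sets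
  suffice, so only countably many points are lost.\<close>

lemma condensation_kernel:
  assumes G: "FSigma.gdelta_in euclideanreal G" "uncountable G"
  obtains N where "N \<subseteq> G" "FSigma.gdelta_in euclideanreal N" "N \<noteq> {}"
    "\<And>U. open U \<Longrightarrow> U \<inter> N \<noteq> {} \<Longrightarrow> uncountable (U \<inter> N)"
proof
  define \<W> where "\<W> = {U. open U \<and> countable (U \<inter> G)}"
  obtain \<V> where V: "\<V> \<subseteq> \<W>" "countable \<V>" "\<Union>\<V> = \<Union>\<W>"
    using Lindelof[of \<W>] by (auto simp: \<W>_def)
  have "countable (\<Union>U\<in>\<V>. U \<inter> G)"
    using V by (intro countable_UN) (auto simp: \<W>_def)
  then have cnt: "countable (G \<inter> \<Union>\<W>)"
    using V(3) by (metis Int_commute Int_Union2)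
  define N where "N = G - \<Union>\<W>"
  show "N \<subseteq> G" by (auto simp: N_def)
  have "open (\<Union>\<W>)"
    by (auto simp: \<W>_def)
  then have "FSigma.gdelta_in euclideanreal (- \<Union>\<W>)"
    by (intro closed_imp_gdelta_in) (auto simp: metrizable_space_euclidean)
  then show "FSigma.gdelta_in euclideanreal N"
    unfolding N_def Diff_eq using G gdelta_in_Int by blast
  show unc: "uncountable (U \<inter> N)" if "open U" "U \<inter> N \<noteq> {}" for U
  proof
    assume "countable (U \<inter> N)"
    then have "countable ((U \<inter> N) \<union> (G \<inter> \<Union>\<W>))"
      using cnt by auto
    then have "countable (U \<inter> G)"
      by (rule countable_subset[rotated]) (auto simp: N_def)
    then show False
      using that by (auto simp: \<W>_def N_def)
  qed
  show "N \<noteq> {}"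
  proof
    assume "N = {}"
    then have "G = G \<inter> \<Union>\<W>" by (auto simp: N_def)
    then show False using G cnt by metis
  qed
qed

text \<open>The kernel \<open>N\<close> is a completely metrizable space without isolated points,
  and such a nonempty space has at least continuum many points.\<close>

lemma lepoll_uncountable_gdelta:
  assumes G: "FSigma.gdelta_in euclideanreal G" "uncountable G"
  shows "(UNIV :: real set) \<lesssim> G"
proof -
  obtain N where N: "N \<subseteq> G" "FSigma.gdelta_in euclideanreal N" "N \<noteq> {}"
    and unc: "\<And>U. open U \<Longrightarrow> U \<inter> N \<noteq> {} \<Longrightarrow> uncountable (U \<inter> N)"
    using condensation_kernel[OF G] by blast
  have "completely_metrizable_space (subtopology euclideanreal N)"
    by (intro completely_metrizable_space_gdelta_in N completely_metrizable_space_euclidean)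
  then obtain M d where M: "Metric_space M d" "Metric_space.mcomplete M d"
    "subtopology euclideanreal N = Metric_space.mtopology M d"
    unfolding completely_metrizable_space_def by blast
  have "(subtopology euclideanreal N) derived_set_of N = N"
  proof (rule set_eqI)
    fix x
    have "\<exists>y. y \<noteq> x \<and> y \<in> N \<and> y \<in> T" if "x \<in> N" "x \<in> T" "open T" for T
    proof (rule ccontr)
      assume "\<nexists>y. y \<noteq> x \<and> y \<in> N \<and> y \<in> T"
      then have "T \<inter> N \<subseteq> {x}" by auto
      then have "countable (T \<inter> N)"
        by (rule countable_subset) simp
      then show False using unc that by blast
    qed
    then show "x \<in> (subtopology euclideanreal N) derived_set_of N \<longleftrightarrow> x \<in> N"
      by (auto simp: in_derived_set_of openin_subtopology)
  qed
  then have "(UNIV :: real set) \<lesssim> N"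
    using Metric_space.lepoll_perfect_set[OF M(1,2)] M(3) N by metis
  then show ?thesis
    using N(1) lepoll_trans subset_imp_lepoll by blast
qed

subsection \<open>A sequential form of the Hurewicz property\<close>

text \<open>The covers are enumerated and open in the ambient space, and finite subfamilies are
  initial segments. A selection is then one function \<open>h\<close>, so selections for different
  subsets can be compared by eventual domination.\<close>

definition hurewicz_on :: "'a topology \<Rightarrow> 'a set \<Rightarrow> bool" where
  "hurewicz_on T S \<longleftrightarrow>
     (\<forall>U :: nat \<Rightarrow> nat \<Rightarrow> 'a set. (\<forall>n m. openin T (U n m)) \<and> (\<forall>n. S \<subseteq> (\<Union>m. U n m)) \<longrightarrow>
        (\<exists>h :: nat \<Rightarrow> nat. \<forall>x\<in>S. \<forall>\<^sub>F n in sequentially. x \<in> (\<Union>m\<le>h n. U n m)))"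

lemma Hurewicz_space_if_hurewicz_on:
  assumes hur: "hurewicz_on T S" and S: "S \<subseteq> topspace T"
    and lin: "Lindelof_space (subtopology T S)"
  shows "Hurewicz_space (subtopology T S)"
  unfolding Hurewicz_space_def
proof (intro allI impI)
  fix \<U> :: "nat \<Rightarrow> 'a set set"
  have top: "topspace (subtopology T S) = S"
    using S by auto
  assume U: "\<forall>n. open_cover (subtopology T S) (\<U> n) \<and>
      \<not> (\<exists>\<F>. finite \<F> \<and> \<F> \<subseteq> \<U> n \<and> \<Union>\<F> = topspace (subtopology T S))"
  have opn: "openin (subtopology T S) U" if "U \<in> \<U> n" for n U
    using U that by (simp add: open_cover_def)
  have cov: "\<Union>(\<U> n) = S" for n
    using U unfolding open_cover_def top by blast
  have nofin: "\<Union>\<F> \<noteq> S" if "finite \<F>" "\<F> \<subseteq> \<U> n" for n \<F>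
    using U[rule_format, of n] that unfolding top by blast
  have "\<exists>\<V>. countable \<V> \<and> \<V> \<subseteq> \<U> n \<and> \<Union>\<V> = S" for n
    using Lindelof_spaceD[OF lin, of "\<U> n"] opn cov top by metis
  then obtain \<V> where V: "\<And>n. countable (\<V> n)" "\<And>n. \<V> n \<subseteq> \<U> n" "\<And>n. \<Union>(\<V> n) = S"
    by metis
  \<comment> \<open>An empty subcover would be a finite one; nonemptiness is what permits the
    enumeration by \<open>from_nat_into\<close>.\<close>
  have ne: "\<V> n \<noteq> {}" for n
    using nofin[of "{}" n] V(3)[of n] by auto
  define v where "v n = from_nat_into (\<V> n)" for n
  have range_v: "range (v n) = \<V> n" for n
    unfolding v_def by (rule range_from_nat_into[OF ne V(1)])
  then have v: "v n m \<in> \<U> n" for n m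
    using V(2) by blast
  have "\<exists>W. openin T W \<and> v n m = W \<inter> S" for n m
    using opn[OF v] by (simp add: openin_subtopology)
  then obtain W where W: "\<And>n m. openin T (W n m)" "\<And>n m. v n m = W n m \<inter> S"
    by metis
  have "S \<subseteq> (\<Union>m. W n m)" for n
    using V(3)[of n] W(2) unfolding range_v[symmetric] by blast
  then obtain h where h: "\<And>x. x \<in> S \<Longrightarrow> \<forall>\<^sub>F n in sequentially. x \<in> (\<Union>m\<le>h n. W n m)"
    using hur W(1) unfolding hurewicz_on_def by meson
  define \<F> where "\<F> n = v n ` {..h n}" for n
  have F: "finite (\<F> n)" "\<F> n \<subseteq> \<U> n" for n
    using v by (auto simp: \<F>_def)
  have ev: "\<forall>\<^sub>F n in sequentially. x \<in> \<Union>(\<F> n)" if "x \<in> S" for x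
    using h[OF that] by (rule eventually_mono) (use that W(2) in \<open>auto simp: \<F>_def\<close>)
  have sub: "\<Union>(\<F> n) \<subseteq> S" for n
    using F(2)[of n] cov[of n] by blast
  \<comment> \<open>Otherwise one union recurs for infinitely many \<open>n\<close>. It is not all
    of \<open>S\<close>, as no finite subcover exists, so a point outside it is missed infinitely
    often.\<close>
  have "infinite (range (\<lambda>n. \<Union>(\<F> n)))"
  proof
    assume fin: "finite (range (\<lambda>n. \<Union>(\<F> n)))"
    obtain k where k: "infinite {n. \<Union>(\<F> n) = \<Union>(\<F> k)}"
      using pigeonhole_infinite[OF infinite_UNIV_nat fin] by auto
    obtain x where x: "x \<in> S" "x \<notin> \<Union>(\<F> k)"
      using nofin[OF F, of k] sub[of k] by blast
    have "finite {n. x \<notin> \<Union>(\<F> n)}"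
      using ev[OF x(1)] by (simp add: cofinite_eq_sequentially[symmetric] eventually_cofinite)
    moreover have "{n. \<Union>(\<F> n) = \<Union>(\<F> k)} \<subseteq> {n. x \<notin> \<Union>(\<F> n)}"
      using x(2) by blast
    ultimately show False
      using k finite_subset by blast
  qed
  moreover have "finite {U \<in> range (\<lambda>n. \<Union>(\<F> n)). x \<notin> U}" if "x \<in> S" for x
  proof -
    have "finite {n. x \<notin> \<Union>(\<F> n)}"
      using ev[OF that] by (simp add: cofinite_eq_sequentially[symmetric] eventually_cofinite)
    then have "finite ((\<lambda>n. \<Union>(\<F> n)) ` {n. x \<notin> \<Union>(\<F> n)})"
      by (rule finite_imageI)
    then show ?thesis
      by (rule finite_subset[rotated]) blast
  qed
  moreover have "\<Union>(range (\<lambda>n. \<Union>(\<F> n))) = S"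
  proof
    show "S \<subseteq> \<Union>(range (\<lambda>n. \<Union>(\<F> n)))"
    proof
      fix x assume "x \<in> S"
      then obtain n where "x \<in> \<Union>(\<F> n)"
        using ev eventually_happens trivial_limit_sequentially by blast
      then show "x \<in> \<Union>(range (\<lambda>n. \<Union>(\<F> n)))"
        by blast
    qed
  qed (use sub in blast)
  moreover have "openin (subtopology T S) (\<Union>(\<F> n))" for n
    using F(2) opn by (intro openin_Union) blast
  ultimately have "point_cofinite_cover (subtopology T S) (range (\<lambda>n. \<Union>(\<F> n)))"
    unfolding point_cofinite_cover_def open_cover_def top by (intro conjI ballI) auto
  then show "\<exists>\<F>. (\<forall>n. finite (\<F> n) \<and> \<F> n \<subseteq> \<U> n) \<and>
      point_cofinite_cover (subtopology T S) (range (\<lambda>n. \<Union>(\<F> n)))"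
    using F by blast
qed

text \<open>The Lindelof theorem is applied in the second countable space of all functions on the
  countable index type: covers are pulled back along restriction to \<open>I\<close>, which fixes
  the points of \<open>S\<close>.\<close>

lemma Lindelof_subspace_power_real:
  fixes I :: "'i :: countable set"
  assumes "S \<subseteq> PiE I (\<lambda>_. UNIV)"
  shows "Lindelof_space (subtopology (product_topology (\<lambda>_. euclideanreal) I) S)"
proof -
  let ?T = "product_topology (\<lambda>_. euclideanreal) I"
  let ?r = "\<lambda>f :: 'i \<Rightarrow> real. restrict f I"
  have "continuous_map euclidean (euclideanreal) (\<lambda>f :: 'i \<Rightarrow> real. f i)" for i
    by (simp add: continuous_map_iff_continuous2)
  then have cont: "continuous_map euclidean ?T ?r"
    by (auto simp: continuous_map_componentwise)
  show ?thesis
    unfolding Lindelof_space_subtopology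
  proof (intro allI impI)
    fix \<U> assume U: "(\<forall>U\<in>\<U>. openin ?T U) \<and> topspace ?T \<inter> S \<subseteq> \<Union>\<U>"
    have "open (?r -` U)" if "U \<in> \<U>" for U
      using openin_continuous_map_preimage[OF cont, of U] U that by (simp add: vimage_def)
    then have "\<And>S. S \<in> (vimage ?r) ` \<U> \<Longrightarrow> open S"
      by blast
    then obtain \<W> where W: "\<W> \<subseteq> (vimage ?r) ` \<U>" "countable \<W>" "\<Union>\<W> = \<Union>((vimage ?r) ` \<U>)"
      by (rule Lindelof)
    then obtain \<V> where V: "\<V> \<subseteq> \<U>" "countable \<V>" "\<W> = (vimage ?r) ` \<V>"
      by (metis countable_subset_image)
    have "topspace ?T \<inter> S \<subseteq> \<Union>\<V>"
    proof
      fix x assume x: "x \<in> topspace ?T \<inter> S"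
      then have r: "?r x = x"
        using assms by (auto simp: PiE_restrict)
      have "x \<in> \<Union>\<U>"
        using x U by blast
      then have "x \<in> \<Union>((vimage ?r) ` \<U>)"
        using r by auto
      then have "x \<in> \<Union>((vimage ?r) ` \<V>)"
        using W(3) V(3) by metis
      then show "x \<in> \<Union>\<V>"
        using r by auto
    qed
    then show "\<exists>V. countable V \<and> V \<subseteq> \<U> \<and> topspace ?T \<inter> S \<subseteq> \<Union>V"
      using V by blast
  qed
qed

text \<open>If no \<open>L g\<close> were inside \<open>W\<close>, the sets \<open>L g - W\<close>
  would be decreasing nonempty closed subsets of the compact \<open>L 0\<close> and would share a
  point.\<close>

lemma nested_compactin_subset_openin:
  fixes L :: "nat \<Rightarrow> 'a set"
  assumes T: "Hausdorff_space T" and L: "\<And>g. compactin T (L g)" and dec: "decseq L"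
    and W: "openin T W" "(\<Inter>g. L g) \<subseteq> W"
  obtains g where "L g \<subseteq> W"
proof (rule ccontr)
  assume "\<not> thesis"
  then have ne: "L g - W \<noteq> {}" for g
    using that by blast
  have sub: "L g \<subseteq> L 0" for g
    using dec by (simp add: decseq_def)
  have "(\<Inter>g. L g - W) \<noteq> {}"
  proof (rule compact_space_imp_nest[of "subtopology T (L 0)"])
    show "compact_space (subtopology T (L 0))"
      using L compact_space_subtopology by blast
    show "closedin (subtopology T (L 0)) (L g - W)" for g
    proof -
      have "closedin T (L g - W)"
        using compactin_imp_closedin[OF T L] W(1) by (rule closedin_diff)
      then show ?thesis
        using sub[of g] by (intro closedin_subset_topspace) auto
    qed
    show "L g - W \<noteq> {}" for g
      by (rule ne)
    show "decseq (\<lambda>g. L g - W)"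
      using dec unfolding decseq_def by blast
  qed
  then show False
    using W(2) by blast
qed

subsection \<open>The Cantor set\<close>

text \<open>The range is the ternary Cantor set scaled by 3/2: the digits are 0 and 1 instead of 0
  and 2, and the weights start at 1.\<close>

definition cantor_real :: "(nat \<Rightarrow> bool) \<Rightarrow> real" where
  "cantor_real x = (\<Sum>i. of_bool (x i) / 3 ^ i)"

lemma summable_inverse_three_power: "summable (\<lambda>i. 1 / 3 ^ i :: real)"
  using summable_geometric[of "1/3 :: real"] by (simp add: power_one_over)

lemma summable_cantor_real: "summable (\<lambda>i. of_bool (x i) / 3 ^ i :: real)"
  by (rule summable_comparison_test'[OF summable_inverse_three_power, of 0]) auto

lemma cantor_real_nonneg: "0 \<le> cantor_real x"
  unfolding cantor_real_def by (intro suminf_nonneg summable_cantor_real) auto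

lemma cantor_real_le: "cantor_real x \<le> 3 / 2"
proof -
  have "cantor_real x \<le> (\<Sum>i. 1 / 3 ^ i)"
    unfolding cantor_real_def
    by (intro suminf_le summable_cantor_real summable_inverse_three_power) auto
  also have "\<dots> = 3 / 2"
    using suminf_geometric[of "1/3 :: real"] by (simp add: power_one_over)
  finally show ?thesis .
qed

lemma cantor_real_shift: "cantor_real x = of_bool (x 0) + cantor_real (\<lambda>i. x (Suc i)) / 3"
proof -
  have "(\<Sum>i. of_bool (x (Suc i)) / 3 ^ Suc i) = cantor_real (\<lambda>i. x (Suc i)) / 3"
    unfolding cantor_real_def by (subst suminf_divide[symmetric, OF summable_cantor_real]) (simp add: field_simps)
  then show ?thesis
    using suminf_split_head[OF summable_cantor_real[of x]] by (simp add: cantor_real_def)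
qed

text \<open>After the first digit the remaining sum lies between 0 and 1/2, so the value determines
  that digit; shifting then gives the later ones.\<close>

lemma inj_cantor_real: "inj cantor_real"
proof (rule injI, rule ext)
  fix x y :: "nat \<Rightarrow> bool" and i
  assume "cantor_real x = cantor_real y"
  then show "x i = y i"
  proof (induction i arbitrary: x y)
    case 0
    then show ?case
      using cantor_real_shift[of x] cantor_real_shift[of y]
        cantor_real_nonneg[of "\<lambda>i. x (Suc i)"] cantor_real_le[of "\<lambda>i. x (Suc i)"]
        cantor_real_nonneg[of "\<lambda>i. y (Suc i)"] cantor_real_le[of "\<lambda>i. y (Suc i)"]
      by (cases "x 0"; cases "y 0") auto
  next
    case (Suc i)
    have "cantor_real (\<lambda>i. x (Suc i)) = cantor_real (\<lambda>i. y (Suc i))"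
      using Suc.prems cantor_real_shift[of x] cantor_real_shift[of y]
        cantor_real_nonneg[of "\<lambda>i. x (Suc i)"] cantor_real_le[of "\<lambda>i. x (Suc i)"]
        cantor_real_nonneg[of "\<lambda>i. y (Suc i)"] cantor_real_le[of "\<lambda>i. y (Suc i)"]
      by (cases "x 0"; cases "y 0") auto
    then show ?case
      using Suc.IH by blast
  qed
qed

lemma continuous_on_of_bool_coordinate:
  "continuous_on UNIV (\<lambda>x::nat \<Rightarrow> bool. of_bool (x i) :: real)"
proof -
  have "continuous_on UNIV (of_bool :: bool \<Rightarrow> real)"
    unfolding continuous_on_open_vimage[OF open_UNIV] by (auto intro: open_discrete)
  then show ?thesis
    using continuous_on_compose2[OF _ continuous_on_product_coordinates[of i]] by blast
qed

lemma continuous_on_cantor_real: "continuous_on UNIV cantor_real"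
proof -
  have "uniform_limit UNIV (\<lambda>n x. \<Sum>i<n. of_bool (x i) / 3 ^ i :: real) cantor_real sequentially"
    unfolding cantor_real_def
    by (rule Weierstrass_m_test[OF _ summable_inverse_three_power]) auto
  then show ?thesis
    by (rule uniform_limit_theorem[rotated])
      (auto intro!: always_eventually continuous_intros continuous_on_of_bool_coordinate)
qed

lemma compact_UNIV_cantor: "compact (UNIV :: (nat \<Rightarrow> bool) set)"
proof -
  have "compact_space (product_topology (\<lambda>i::nat. euclidean :: bool topology) UNIV)"
    by (simp add: compact_space_product_topology) (simp add: compact_space_def compactin_euclidean_iff finite_imp_compact)
  then show ?thesis
    by (simp add: euclidean_product_topology compact_space_def compactin_euclidean_iff)
qed

section \<open>Clopen sets of binary sequences with few ones\<close>

definition few_bits :: "nat \<Rightarrow> nat \<Rightarrow> (nat \<Rightarrow> bool) set" where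
  "few_bits m g = {x. card {i. i < g \<and> x i} \<le> m}"

lemma sum_of_bool_lessThan:
  fixes x :: "nat \<Rightarrow> bool"
  shows "(\<Sum>i<g. of_bool (x i)) = real (card {i. i < g \<and> x i})"
  by (simp add: of_bool_def sum.If_cases lessThan_def Int_def)

text \<open>The number of ones below \<open>g\<close> is a continuous function with integer values,
  so the set and its complement are both given by closed inequalities in the compact Cantor
  space.\<close>

lemma compact_few_bits: "compact (few_bits m g)" "compact (- few_bits m g)"
proof -
  have c: "continuous_on UNIV (\<lambda>x::nat \<Rightarrow> bool. \<Sum>i<g. of_bool (x i) :: real)"
    by (intro continuous_on_sum continuous_on_of_bool_coordinate)
  have "few_bits m g = {x. (\<Sum>i<g. of_bool (x i)) \<le> real m}"
    by (auto simp: few_bits_def sum_of_bool_lessThan)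
  then have "closed (few_bits m g)"
    by (simp only:) (intro closed_Collect_le c continuous_on_const)
  then show "compact (few_bits m g)"
    using compact_UNIV_cantor compact_Int_closed[of UNIV] by simp
  have "- few_bits m g = {x. real (Suc m) \<le> (\<Sum>i<g. of_bool (x i))}"
    by (auto simp: few_bits_def sum_of_bool_lessThan)
  then have "closed (- few_bits m g)"
    by (simp only:) (intro closed_Collect_le c continuous_on_const)
  then show "compact (- few_bits m g)"
    using compact_UNIV_cantor compact_Int_closed[of UNIV] by simp
qed

lemma few_bits_antimono: "g \<le> g' \<Longrightarrow> few_bits m g' \<subseteq> few_bits m g"
proof
  fix x assume "g \<le> g'" "x \<in> few_bits m g'"
  moreover from \<open>g \<le> g'\<close> have "card {i. i < g \<and> x i} \<le> card {i. i < g' \<and> x i}"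
    by (intro card_mono) auto
  ultimately show "x \<in> few_bits m g"
    by (simp add: few_bits_def)
qed

lemma finite_if_few_bits:
  assumes "\<And>g. x \<in> few_bits m g"
  shows "finite {i. x i}"
proof (rule ccontr)
  assume "infinite {i. x i}"
  then obtain S where S: "S \<subseteq> {i. x i}" "finite S" "card S = Suc m"
    using infinite_arbitrarily_large by blast
  obtain g where "\<forall>i\<in>S. i < g"
    using S(2) finite_nat_set_iff_bounded by blast
  then have "card S \<le> card {i. i < g \<and> x i}"
    using S by (intro card_mono) auto
  then show False
    using assms[of g] S by (simp add: few_bits_def)
qed

lemma countable_finite_bits: "countable {x :: nat \<Rightarrow> bool. finite {i. x i}}"
proof -
  have "{x :: nat \<Rightarrow> bool. finite {i. x i}} = (\<lambda>A i. i \<in> A) ` Collect finite"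
    by (auto simp: image_def) 
  then show ?thesis
    by (simp only:) (rule countable_image, rule countable_Collect_finite)
qed

text \<open>Take the range of a strictly increasing \<open>a\<close> with
  \<open>h m \<le> a m\<close>: only the \<open>m\<close> values \<open>a j\<close> with
  \<open>j < m\<close> can lie below \<open>h m\<close>.\<close>

lemma exists_sparse_bits: "\<exists>x. infinite {i. x i} \<and> (\<forall>m. x \<in> few_bits m (h m))"
proof -
  \<comment> \<open>The partial sums dominate \<open>h\<close>, and the summand \<open>m\<close>
    makes the growth strict.\<close>
  define a where "a m = (\<Sum>j\<le>m. h j) + m" for m
  have a: "strict_mono a"
    by (rule strict_mono_Suc_iff[THEN iffD2]) (simp add: a_def)
  have "h m \<le> a m" for m
    unfolding a_def by (simp add: member_le_sum trans_le_add1)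
  have "range a \<inter> {..<h m} \<subseteq> a ` {..<m}" for m
  proof clarify
    fix j assume "a j < h m"
    then have "a j < a m" using \<open>h m \<le> a m\<close> by simp
    then have "j < m" using a strict_mono_less by blast
    then show "a j \<in> a ` {..<m}" by simp
  qed
  then have "card (range a \<inter> {..<h m}) \<le> m" for m
    by (metis card_image_le card_lessThan card_mono finite_imageI finite_lessThan le_trans)
  then have "(\<lambda>i. i \<in> range a) \<in> few_bits m (h m)" for m
    by (simp add: few_bits_def Int_def conj_commute)
  moreover have "infinite {i. i \<in> range a}"
    using a by (simp add: finite_image_iff strict_mono_imp_inj_on)
  ultimately show ?thesis
    by blast
qed

text \<open>
  In the intended model \<open>Z\<close> is a copy of the Cantor space, \<open>K m g\<close> consists of the sets of naturals
  with at most \<open>m\<close> elements below \<open>g\<close>, and the points of \<open>\<Union>m. \<Inter>g. K m g\<close> are the finite sets.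
  On the infinite sets, the function \<open>escape x\<close> defined below is then essentially the increasing
  enumeration of \<open>x\<close>.
\<close>
locale cantor_grid =
  fixes K :: "nat \<Rightarrow> nat \<Rightarrow> real set" and Z :: "real set"
  assumes compact_K: "compact (K m g)"
    and compact_co_K: "compact (Z - K m g)"
    and K_antimono: "g \<le> g' \<Longrightarrow> K m g' \<subseteq> K m g"
    and K_mono: "m \<le> m' \<Longrightarrow> K m g \<subseteq> K m' g"
    and countable_core: "countable (\<Union>m. \<Inter>g. K m g)"
    and slow_point: "\<exists>x\<in>Z - (\<Union>m. \<Inter>g. K m g). \<forall>m. x \<in> K m (h m)"

lemma cantor_grid_cantor_real:
  "cantor_grid (\<lambda>m g. cantor_real ` few_bits m g) (range cantor_real)"
proof
  have cont: "continuous_on S cantor_real" for S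
    using continuous_on_cantor_real continuous_on_subset by blast
  show "compact (cantor_real ` few_bits m g)" for m g
    by (intro compact_continuous_image cont compact_few_bits)
  have "range cantor_real - cantor_real ` few_bits m g = cantor_real ` (- few_bits m g)" for m g
    using inj_cantor_real by (auto simp: inj_def)
  then show "compact (range cantor_real - cantor_real ` few_bits m g)" for m g
    by (simp add: compact_continuous_image cont compact_few_bits)
  have core: "(\<Inter>g. cantor_real ` few_bits m g) = cantor_real ` (\<Inter>g. few_bits m g)" for m
    by (rule image_INT[symmetric, of _ UNIV _ _ 0]) (auto simp: inj_cantor_real)
  have "(\<Union>m. \<Inter>g. cantor_real ` few_bits m g) \<subseteq> cantor_real ` {x. finite {i. x i}}"
    unfolding core using finite_if_few_bits by (auto intro!: imageI)
  then show "countable (\<Union>m. \<Inter>g. cantor_real ` few_bits m g)"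
    using countable_finite_bits countable_subset countable_image by meson
  show "\<exists>x\<in>range cantor_real - (\<Union>m. \<Inter>g. cantor_real ` few_bits m g).
      \<forall>m. x \<in> cantor_real ` few_bits m (h m)" for h
  proof -
    obtain x where x: "infinite {i. x i}" "\<And>m. x \<in> few_bits m (h m)"
      using exists_sparse_bits by blast
    have "cantor_real x \<notin> (\<Union>m. \<Inter>g. cantor_real ` few_bits m g)"
      unfolding core using finite_if_few_bits x(1) inj_cantor_real
      by (auto simp: inj_image_mem_iff)
    then show ?thesis
      using x by (intro bexI[of _ "cantor_real x"]) auto
  qed
qed (auto simp: few_bits_def dest: few_bits_antimono[THEN subsetD])

subsection \<open>Scales\<close>

definition eventually_bounded :: "(nat \<Rightarrow> nat) set \<Rightarrow> bool" where
  "eventually_bounded F \<longleftrightarrow> (\<exists>g. \<forall>f\<in>F. \<forall>\<^sub>F n in sequentially. f n \<le> g n)"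

text \<open>Diagonalize: from index \<open>i\<close> on, the function \<open>f i\<close> is one of
  the summands of the bound.\<close>

lemma eventually_bounded_countable:
  assumes "countable F"
  shows "eventually_bounded F"
proof (cases "F = {}")
  case False
  define f where "f = from_nat_into F"
  have f: "F = range f"
    unfolding f_def using range_from_nat_into[OF False assms] by simp
  have "\<forall>\<^sub>F n in sequentially. f i n \<le> (\<Sum>j\<le>n. f j n)" for i
    using eventually_ge_at_top[of i]
    by eventually_elim (auto intro: member_le_sum)
  then show ?thesis
    unfolding eventually_bounded_def f by (auto intro!: exI[of _ "\<lambda>n. \<Sum>j\<le>n. f j n"])
qed (simp add: eventually_bounded_def)

section \<open>Escape functions and families of least unbounded size\<close>

context cantor_grid
begin

definition core :: "real set" where
  "core = (\<Union>m. \<Inter>g. K m g)"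

text \<open>Outside \<open>core\<close> the minimum exists for every \<open>m\<close>. In the Cantor
  model it is one more than the element of index \<open>m\<close>, counted from 0, of the infinite
  set \<open>x\<close>.\<close>

definition escape :: "real \<Rightarrow> nat \<Rightarrow> nat" where
  "escape x m = (LEAST g. x \<notin> K m g)"

lemma mem_K_iff:
  assumes "x \<notin> core"
  shows "x \<in> K m g \<longleftrightarrow> g < escape x m"
proof -
  obtain g0 where g0: "x \<notin> K m g0"
    using assms by (auto simp: core_def)
  then have "x \<notin> K m (escape x m)"
    unfolding escape_def by (rule LeastI)
  then have "x \<notin> K m g" if "escape x m \<le> g"
    using K_antimono[OF that] by blast
  moreover have "x \<in> K m g" if "g < escape x m"
    using not_less_Least[of g "\<lambda>g. x \<notin> K m g"] that by (auto simp: escape_def)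
  ultimately show ?thesis
    by force
qed

text \<open>Escape functions form a dominating family, which lets points of \<open>Z - core\<close>
  stand for arbitrary functions below.\<close>

lemma exists_escape_ge: "\<exists>x\<in>Z - core. \<forall>m. h m \<le> escape x m"
proof -
  obtain x where x: "x \<in> Z - core" "\<And>m. x \<in> K m (h m)"
    using slow_point[of h] by (auto simp: core_def)
  then have "h m \<le> escape x m" for m
    using mem_K_iff[of x m "h m"] by auto
  with x(1) show ?thesis
    by blast
qed

lemma unbounded_escape:
  "\<not> eventually_bounded (escape ` (Z - core))"
proof
  assume "eventually_bounded (escape ` (Z - core))"
  then obtain g where g: "\<And>x. x \<in> Z - core \<Longrightarrow> \<forall>\<^sub>F n in sequentially. escape x n \<le> g n"
    by (auto simp: eventually_bounded_def)
  obtain x where x: "x \<in> Z - core" "\<And>m. Suc (g m) \<le> escape x m"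
    using exists_escape_ge[of "\<lambda>m. Suc (g m)"] by blast
  from g[OF x(1)] have "\<forall>\<^sub>F n :: nat in sequentially. False"
    by (rule eventually_mono) (use x(2) not_less_eq_eq in blast)
  then show False by simp
qed

text \<open>The relation \<open><o\<close> is well-founded, so among the sets with an unbounded
  escape family there is one of least cardinality.\<close>

lemma minimal_unbounded:
  obtains B where "B \<subseteq> Z - core" "\<not> eventually_bounded (escape ` B)"
    "\<And>B'. B' \<subseteq> Z - core \<Longrightarrow> |B'| <o |B| \<Longrightarrow> eventually_bounded (escape ` B')"
proof -
  let ?\<B> = "card_of ` {B. B \<subseteq> Z - core \<and> \<not> eventually_bounded (escape ` B)}"
  have "card_of (Z - core) \<in> ?\<B>"
    using unbounded_escape by blast
  from wfE_min[OF wf_ordLess this]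
  obtain r where r: "r \<in> ?\<B>" "\<And>r'. r' <o r \<Longrightarrow> r' \<notin> ?\<B>"
    by blast
  then obtain B where B: "B \<subseteq> Z - core" "\<not> eventually_bounded (escape ` B)" "r = |B|"
    by blast
  have "eventually_bounded (escape ` B')" if "B' \<subseteq> Z - core" "|B'| <o |B|" for B'
    using r(2)[of "|B'|"] that B(3) by blast
  then show thesis
    using that B by blast
qed

lemma bounded_if_card_less:
  fixes h :: "'a \<Rightarrow> nat \<Rightarrow> nat"
  assumes B: "\<And>B'. B' \<subseteq> Z - core \<Longrightarrow> |B'| <o |B| \<Longrightarrow> eventually_bounded (escape ` B')"
    and A: "|A| <o |B|"
  shows "\<exists>g. \<forall>a\<in>A. \<forall>\<^sub>F n in sequentially. h a n \<le> g n"
proof -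
  have "\<forall>a. \<exists>x. x \<in> Z - core \<and> (\<forall>m. h a m \<le> escape x m)"
    using exists_escape_ge by blast
  then obtain p where p: "\<And>a. p a \<in> Z - core" "\<And>a m. h a m \<le> escape (p a) m"
    by metis
  have "|p ` A| <o |B|"
    using card_of_image A ordLeq_ordLess_trans by blast
  then have "eventually_bounded (escape ` p ` A)"
    using p(1) by (intro B) auto
  then obtain g where g: "\<And>a. a \<in> A \<Longrightarrow> \<forall>\<^sub>F n in sequentially. escape (p a) n \<le> g n"
    by (auto simp: eventually_bounded_def)
  have "\<forall>\<^sub>F n in sequentially. h a n \<le> g n" if "a \<in> A" for a
    using g[OF that] by (rule eventually_mono) (use p(2) le_trans in blast)
  then show ?thesis by blast
qed

end

text \<open>
  The cardinality of \<open>B\<close> is the bounding number \<open>\<bb>\<close> and \<open>s\<close> is a \<open>\<bb>\<close>-scale indexed by the initial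
  ordinal \<open>|B|\<close>; \<open>initial_bounded\<close> says that fewer than \<open>\<bb>\<close> functions are always bounded.
\<close>
locale cantor_scale = cantor_grid +
  fixes B :: "real set" and s :: "real \<Rightarrow> real"
  assumes s_mem: "a \<in> B \<Longrightarrow> s a \<in> Z - core"
    and s_increasing: "a \<in> B \<Longrightarrow> c \<in> underS |B| a \<Longrightarrow> \<forall>\<^sub>F n in sequentially. escape (s c) n \<le> escape (s a) n"
    and s_unbounded: "\<exists>a\<in>B. \<not> (\<forall>\<^sub>F n in sequentially. escape (s a) n \<le> g n)"
    and initial_bounded: "a \<in> B \<Longrightarrow> \<exists>g. \<forall>c\<in>underS |B| a. \<forall>\<^sub>F n in sequentially. (h c n :: nat) \<le> g n"

text \<open>Recursion along the cardinal order of \<open>B\<close>. The point \<open>s a\<close>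
  must dominate \<open>escape a\<close>, which keeps the family unbounded, and a bound of all
  earlier values, which exists because proper initial segments of \<open>|B|\<close> are smaller
  than \<open>B\<close>.\<close>

lemma (in cantor_grid) exists_cantor_scale: "\<exists>B s. cantor_scale K Z B s"
proof -
  obtain B where B: "B \<subseteq> Z - core" "\<not> eventually_bounded (escape ` B)"
    and min: "\<And>B'. B' \<subseteq> Z - core \<Longrightarrow> |B'| <o |B| \<Longrightarrow> eventually_bounded (escape ` B')"
    using minimal_unbounded by blast
  have init: "\<exists>g. \<forall>c\<in>underS |B| a. \<forall>\<^sub>F n in sequentially. (h c n :: nat) \<le> g n" if "a \<in> B" for a and h :: "real \<Rightarrow> nat \<Rightarrow> nat"
    using card_of_underS[OF card_of_Card_order, of a B] that
    by (intro bounded_if_card_less[OF min]) (simp_all add: Field_card_of)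
  \<comment> \<open>The recursion ranges over all reals; outside \<open>B\<close> any point of
    \<open>Z - core\<close> is accepted.\<close>
  define P where "P f a v \<longleftrightarrow> v \<in> Z - core \<and> (a \<in> B \<longrightarrow> (\<forall>n. escape a n \<le> escape v n) \<and>
      (\<forall>c\<in>underS |B| a. \<forall>\<^sub>F n in sequentially. escape (f c) n \<le> escape v n))" for f a v
  have wf: "wf ( |B| - Id)"
    using card_of_Well_order[of B] well_order_on_def by blast
  have "\<exists>f. \<forall>a. P f a (f a)"
  proof (rule dependent_wf_choice[OF wf])
    show "P f x r = P g x r" if "\<And>z. (z, x) \<in> |B| - Id \<Longrightarrow> f z = g z" for f g x r
    proof -
      have "f c = g c" if "c \<in> underS |B| x" for c
        using \<open>\<And>z. (z, x) \<in> |B| - Id \<Longrightarrow> f z = g z\<close> that by (auto simp: underS_def)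
      then show ?thesis
        by (simp add: P_def)
    qed
    show "\<exists>r. P f x r" for x f
    proof (cases "x \<in> B")
      case True
      then obtain g where g: "\<And>c. c \<in> underS |B| x \<Longrightarrow> \<forall>\<^sub>F n in sequentially. escape (f c) n \<le> g n"
        using init[of x "\<lambda>c. escape (f c)"] by blast
      obtain v where v: "v \<in> Z - core" "\<And>n. max (escape x n) (g n) \<le> escape v n"
        using exists_escape_ge[of "\<lambda>n. max (escape x n) (g n)"] by blast
      have "\<forall>\<^sub>F n in sequentially. escape (f c) n \<le> escape v n" if "c \<in> underS |B| x" for c
        using g[OF that] by (rule eventually_mono) (use v(2) in \<open>auto intro: le_trans\<close>)
      then show ?thesis
        using v by (intro exI[of _ v]) (auto simp: P_def)
    next
      case False
      then show ?thesis
        using exists_escape_ge by (auto simp: P_def)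
    qed
  qed
  then obtain s where s: "\<And>a. P s a (s a)"
    by blast
  have "cantor_scale K Z B s"
  proof unfold_locales
    show "\<exists>a\<in>B. \<not> (\<forall>\<^sub>F n in sequentially. escape (s a) n \<le> g n)" for g
    proof (rule ccontr)
      assume "\<not> (\<exists>a\<in>B. \<not> (\<forall>\<^sub>F n in sequentially. escape (s a) n \<le> g n))"
      then have g: "\<forall>\<^sub>F n in sequentially. escape (s a) n \<le> g n" if "a \<in> B" for a
        using that by blast
      have "\<forall>\<^sub>F n in sequentially. escape a n \<le> g n" if "a \<in> B" for a
        using g[OF that] by (rule eventually_mono) (use s[of a] that P_def le_trans in blast)
      then show False
        using B(2) by (auto simp: eventually_bounded_def)
    qed
  qed (use s init in \<open>auto simp: P_def\<close>)
  then show ?thesis by blast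
qed

subsection \<open>The space and its compact subsets\<close>

context cantor_grid
begin

lemma compact_Inter_K: "compact (\<Inter>g. K m g)"
proof -
  have "closed (\<Inter>g. K m g)"
    using compact_K compact_imp_closed by blast
  moreover have "(\<Inter>g. K m g) = K m 0 \<inter> (\<Inter>g. K m g)"
    by blast
  ultimately show ?thesis
    using compact_K compact_Int_closed by metis
qed

text \<open>The inequality fails at \<open>m\<close> exactly when some \<open>K m g\<close> contains
  \<open>x\<close> but not \<open>y\<close>. Each \<open>K m g\<close> is relatively clopen in
  \<open>N\<close>, so the complement is a union of open boxes \<open>W m g\<close>.\<close>

lemma closedin_escape_le:
  assumes N: "N \<subseteq> Z - core"
  shows "closedin (prod_topology (subtopology euclideanreal N) (subtopology euclideanreal N))
    {(x, y). x \<in> N \<and> y \<in> N \<and> (\<forall>m\<ge>n. escape x m \<le> escape y m)}"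
    (is "closedin ?P ?S")
proof -
  define W where "W m g = (N \<inter> K m g) \<times> (N - K m g)" for m g
  have "openin ?P (W m g)" for m g
  proof -
    have "closed (Z - K m g)" "closed (K m g)"
      using compact_co_K compact_K compact_imp_closed by blast+
    moreover have "N \<inter> K m g = N \<inter> - (Z - K m g)" "N - K m g = N \<inter> - K m g"
      using N by auto
    ultimately have "openin (subtopology euclideanreal N) (N \<inter> K m g)"
      "openin (subtopology euclideanreal N) (N - K m g)"
      by (metis open_Compl openin_open_Int)+
    then show ?thesis
      unfolding W_def openin_prod_Times_iff by blast
  qed
  then have "openin ?P (\<Union>m\<in>{n..}. \<Union>g. W m g)"
    by (intro openin_Union) auto
  moreover have "?S = topspace ?P - (\<Union>m\<in>{n..}. \<Union>g. W m g)"
  proof -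
    have "escape x m \<le> escape y m \<longleftrightarrow> (\<forall>g. x \<in> K m g \<longrightarrow> y \<in> K m g)" if "x \<in> N" "y \<in> N" for x y m
    proof -
      have "x \<notin> core" "y \<notin> core"
        using that N by auto
      then have "(\<forall>g. x \<in> K m g \<longrightarrow> y \<in> K m g) \<longleftrightarrow> (\<forall>g. g < escape x m \<longrightarrow> g < escape y m)"
        using mem_K_iff by simp
      also have "\<dots> \<longleftrightarrow> escape x m \<le> escape y m"
        by (meson leI less_le_trans less_irrefl)
      finally show ?thesis by simp
    qed
    then show ?thesis
      by (auto simp: W_def)
  qed
  ultimately show ?thesis
    by (simp only: closedin_diff closedin_topspace)
qed

end

context cantor_scale
begin

definition X :: "real set" where
  "X = core \<union> s ` B"

lemma B_cases:
  assumes "a \<in> B" "c \<in> B"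
  shows "a = c \<or> a \<in> underS |B| c \<or> c \<in> underS |B| a"
proof -
  have "total_on B |B|"
    using card_of_Well_order[of B] by (simp add: well_order_on_def linear_order_on_def Field_card_of)
  then show ?thesis
    using assms by (auto simp: total_on_def underS_def)
qed

lemma uncountable_scale: "uncountable (s ` B)"
proof
  assume "countable (s ` B)"
  then have "eventually_bounded (escape ` s ` B)"
    by (intro eventually_bounded_countable countable_image[of "s ` B"])
  then show False
    using s_unbounded by (auto simp: eventually_bounded_def)
qed

text \<open>Some \<open>s d\<close> is not bounded by \<open>g\<close>. Neither \<open>s d\<close>
  nor any later scale point can then be in \<open>A\<close>, so \<open>A\<close> is covered by an
  initial segment, which is smaller than \<open>B\<close> and hence than the continuum.\<close>

lemma not_lepoll_bounded:
  assumes A: "A \<subseteq> s ` B" and g: "\<And>x. x \<in> A \<Longrightarrow> \<forall>\<^sub>F n in sequentially. escape x n \<le> g n"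
  shows "\<not> (UNIV :: real set) \<lesssim> A"
proof
  assume "(UNIV :: real set) \<lesssim> A"
  then have le: "|UNIV :: real set| \<le>o |A|"
    unfolding lepoll_def card_of_ordLeq .
  obtain d where d: "d \<in> B" "\<not> (\<forall>\<^sub>F n in sequentially. escape (s d) n \<le> g n)"
    using s_unbounded by blast
  have "A \<subseteq> s ` underS |B| d"
  proof
    fix x assume x: "x \<in> A"
    then obtain a where a: "a \<in> B" "x = s a"
      using A by blast
    have "\<forall>\<^sub>F n in sequentially. escape (s d) n \<le> g n" if "d \<in> underS |B| a"
      using s_increasing[OF a(1) that] g[OF x] by eventually_elim (simp add: a)
    moreover have "a \<noteq> d"
      using d(2) g[OF x] a(2) by blast
    ultimately have "a \<in> underS |B| d"
      using B_cases[OF a(1) d(1)] d(2) by blast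
    then show "x \<in> s ` underS |B| d"
      using a(2) by blast
  qed
  then have "|A| \<le>o |underS |B| d|"
    using card_of_mono1 card_of_image ordLeq_transitive by blast
  also have "|underS |B| d| <o |B|"
    using card_of_underS[OF card_of_Card_order, of d B] d(1) by (simp add: Field_card_of)
  also have "|B| \<le>o |UNIV :: real set|"
    by (rule card_of_mono1) simp
  finally have "|A| <o |UNIV :: real set|" .
  then show False
    using le not_ordLess_ordLeq by blast
qed

text \<open>
  Otherwise there is a crowded \<open>G\<^sub>\<delta>\<close> set \<open>N \<subseteq> s ` B\<close>. As the scale is linearly ordered by eventual
  domination, \<open>N \<times> N\<close> is the union of the closed sets \<open>Le n\<close> and \<open>Ge n\<close>, so by Baire one of them
  contains an open box. One side of the box is then bounded by a single function and hence has
  fewer than \<open>\<bb>\<close> elements, although it is an uncountable \<open>G\<^sub>\<delta>\<close> set and so has size continuum.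
\<close>
lemma countable_closed_subset_X:
  assumes C: "closed C" "C \<subseteq> X"
  shows "countable C"
proof (rule ccontr)
  assume unc: "uncountable C"
  \<comment> \<open>Being countable, \<open>core\<close> can be removed from \<open>C\<close>
    without losing the G-delta property or uncountability.\<close>
  have "FSigma.fsigma_in euclideanreal core"
  proof -
    have "FSigma.fsigma_in euclideanreal (\<Union>x\<in>core. {x})"
      using countable_core unfolding core_def[symmetric]
      by (intro fsigma_in_Union) (auto intro: closed_imp_fsigma_in)
    then show ?thesis by simp
  qed
  moreover have gC: "FSigma.gdelta_in euclideanreal C"
    using C(1) by (intro closed_imp_gdelta_in) (auto simp: metrizable_space_euclidean)
  ultimately have "FSigma.gdelta_in euclideanreal (C - core)"
    using gdelta_in_diff by blast
  moreover have "uncountable (C - core)"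
    using unc countable_core unfolding core_def[symmetric] by (rule uncountable_minus_countable)
  ultimately obtain N where N: "N \<subseteq> C - core" "FSigma.gdelta_in euclideanreal N" "N \<noteq> {}"
    and uncN: "\<And>U. open U \<Longrightarrow> U \<inter> N \<noteq> {} \<Longrightarrow> uncountable (U \<inter> N)"
    using condensation_kernel by metis
  have NB: "N \<subseteq> s ` B"
    using N(1) C(2) by (auto simp: X_def)
  then have NZ: "N \<subseteq> Z - core"
    using s_mem by blast
  let ?N = "subtopology euclideanreal N"
  let ?P = "prod_topology ?N ?N"
  define Le where "Le n = {(x, y). x \<in> N \<and> y \<in> N \<and> (\<forall>m\<ge>n. escape x m \<le> escape y m)}" for n
  define Ge where "Ge n = {(x, y). x \<in> N \<and> y \<in> N \<and> (\<forall>m\<ge>n. escape y m \<le> escape x m)}" for n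
  have no_box: False
    if V: "openin ?N V" "V \<noteq> {}" and y: "\<And>x. x \<in> V \<Longrightarrow> \<forall>m\<ge>n. escape x m \<le> escape y m" for V y n
  proof -
    obtain U where U: "open U" "V = U \<inter> N"
      using V(1) by (auto simp: openin_open)
    then have "uncountable V"
      using uncN V(2) by blast
    moreover have "FSigma.gdelta_in euclideanreal V"
      unfolding U(2) using N(2) U(1) by (intro gdelta_in_Int open_imp_gdelta_in[of euclideanreal U]) auto
    ultimately have "(UNIV :: real set) \<lesssim> V"
      by (intro lepoll_uncountable_gdelta)
    moreover have "\<not> (UNIV :: real set) \<lesssim> V"
    proof (rule not_lepoll_bounded)
      show "V \<subseteq> s ` B"
        using U(2) NB by blast
      show "\<forall>\<^sub>F n in sequentially. escape x n \<le> escape y n" if "x \<in> V" for x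
        using y[OF that] by (auto simp: eventually_sequentially)
    qed
    ultimately show False by blast
  qed
  have "?P interior_of \<Union>(range Le \<union> range Ge) = {}"
  proof (rule Baire_category_alt)
    have "completely_metrizable_space ?N"
      by (intro completely_metrizable_space_gdelta_in N completely_metrizable_space_euclidean)
    then show "completely_metrizable_space ?P \<or> locally_compact_space ?P \<and> regular_space ?P"
      using completely_metrizable_space_prod_topology by blast
    show "countable (range Le \<union> range Ge)"
      by auto
    fix T assume T: "T \<in> range Le \<union> range Ge"
    have "closedin ?P (Le n)" for n
      unfolding Le_def by (rule closedin_escape_le[OF NZ])
    moreover have "closedin ?P (Ge n)" for n
    proof -
      have "continuous_map ?P ?P (\<lambda>z. (snd z, fst z))"
        unfolding continuous_map_paired by (intro conjI continuous_map_fst continuous_map_snd)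
      moreover have "Ge n = {z \<in> topspace ?P. (snd z, fst z) \<in> Le n}"
        by (auto simp: Ge_def Le_def)
      ultimately show ?thesis
        using \<open>closedin ?P (Le n)\<close> by (simp only: closedin_continuous_map_preimage)
    qed
    moreover have "?P interior_of T = {}"
    proof (rule ccontr)
      assume "?P interior_of T \<noteq> {}"
      then obtain x y where "(x, y) \<in> ?P interior_of T"
        by auto
      then obtain V W where VW: "openin ?N V" "openin ?N W" "x \<in> V" "y \<in> W" "V \<times> W \<subseteq> ?P interior_of T"
        using openin_interior_of[of ?P T] unfolding openin_prod_topology_alt by meson
      have sub: "V \<times> W \<subseteq> T"
        using VW(5) interior_of_subset[of ?P T] by (rule subset_trans)
      from T consider n where "T = Le n" | n where "T = Ge n"
        by blast
      then show False
      proof cases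
        case 1
        show False
          by (rule no_box[OF VW(1), of n y]) (use sub VW 1 in \<open>auto simp: Le_def\<close>)
      next
        case 2
        show False
          by (rule no_box[OF VW(2), of n x]) (use sub VW 2 in \<open>auto simp: Ge_def\<close>)
      qed
    qed
    ultimately show "closedin ?P T \<and> ?P interior_of T = {}"
      using T by blast
  qed
  moreover have "\<Union>(range Le \<union> range Ge) = topspace ?P"
  proof
    show "topspace ?P \<subseteq> \<Union>(range Le \<union> range Ge)"
    proof clarify
      fix x y assume "(x, y) \<in> topspace ?P"
      then have xy: "x \<in> N" "y \<in> N" by auto
      then obtain a c where ac: "a \<in> B" "x = s a" "c \<in> B" "y = s c"
        using NB by blast
      have "(\<forall>\<^sub>F n in sequentially. escape x n \<le> escape y n) \<or> (\<forall>\<^sub>F n in sequentially. escape y n \<le> escape x n)"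
        using B_cases[OF ac(1,3)] s_increasing ac by auto
      then show "(x, y) \<in> \<Union>(range Le \<union> range Ge)"
        using xy by (auto simp: Le_def Ge_def eventually_sequentially)
    qed
  qed (auto simp: Le_def Ge_def)
  ultimately have "topspace ?P = {}"
    by (metis interior_of_topspace)
  then show False
    using N(3) by simp
qed

end

subsection \<open>Powers of the space\<close>

context cantor_scale
begin

abbreviation power_X :: "nat set \<Rightarrow> (nat \<Rightarrow> real) set" where
  "power_X I \<equiv> PiE I (\<lambda>_. X)"

abbreviation power_top :: "nat set \<Rightarrow> (nat \<Rightarrow> real) topology" where
  "power_top I \<equiv> product_topology (\<lambda>_. euclideanreal) I"

text \<open>Freezing the coordinates in \<open>J\<close> gives copies of lower powers inside one
  fixed ambient space, so the induction can reuse the same open sets.\<close>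

definition slice :: "nat set \<Rightarrow> nat set \<Rightarrow> (nat \<Rightarrow> real) \<Rightarrow> (nat \<Rightarrow> real) set" where
  "slice I J p = {x \<in> power_X I. \<forall>i\<in>J. x i = p i}"

text \<open>A box with frozen coordinates in \<open>J\<close> and the others in the compact set
  \<open>\<Inter>g. K m g\<close> is compact, and it lies in the slice because
  \<open>core \<subseteq> X\<close>.\<close>

lemma slice_core_cover:
  fixes U :: "nat \<Rightarrow> (nat \<Rightarrow> real) set"
  assumes I: "finite I" and J: "J \<subseteq> I" and p: "p \<in> power_X I"
    and U: "\<And>m. openin (power_top I) (U m)" "slice I J p \<subseteq> (\<Union>m. U m)"
  shows "\<exists>j. PiE I (\<lambda>i. if i \<in> J then {p i} else \<Inter>g. K m g) \<subseteq> (\<Union>l\<le>j. U l)"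
    (is "\<exists>j. ?L \<subseteq> _")
proof -
  have "compactin (power_top I) ?L"
    unfolding compactin_PiE using compact_Inter_K by auto
  moreover have "?L \<subseteq> \<Union>(range U)"
  proof -
    have "?L \<subseteq> slice I J p"
    proof
      fix x assume x: "x \<in> ?L"
      have "x i \<in> X" if "i \<in> I" for i
        using PiE_mem[OF x that] PiE_mem[OF p that] by (cases "i \<in> J") (auto simp: X_def core_def)
      moreover have "x i = p i" if "i \<in> J" for i
        using PiE_mem[OF x, of i] that J by auto
      moreover have "x \<in> extensional I"
        using x by (simp add: PiE_def)
      ultimately show "x \<in> slice I J p"
        by (auto simp: slice_def PiE_def)
    qed
    then show ?thesis
      using U(2) by blast
  qed
  ultimately obtain \<F> where \<F>: "finite \<F>" "\<F> \<subseteq> range U" "?L \<subseteq> \<Union>\<F>"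
    using compactinD[of "power_top I" ?L "range U"] U(1) by blast
  obtain S where S: "finite S" "\<F> = U ` S"
    using finite_subset_image[OF \<F>(1,2)] by blast
  obtain j where j: "S \<subseteq> {..j}"
    using finite_nat_iff_bounded_le[THEN iffD1, OF S(1)] by blast
  have "?L \<subseteq> \<Union>(U ` S)"
    using \<F>(3) S(2) by simp
  also have "\<dots> \<subseteq> (\<Union>l\<le>j. U l)"
    using j by (intro UN_mono) auto
  finally show ?thesis
    by blast
qed

text \<open>
  If \<open>g m < escape (s a) m\<close> for infinitely many \<open>m\<close>, then for every later scale point \<open>s c\<close> this
  holds for almost all of the \<^emph>\<open>same\<close> \<open>m\<close>; covers with other indices \<open>n\<close> are served by the next
  such \<open>m \<ge> n\<close>, which is why \<open>W m\<close> handles all covers of index at most \<open>m\<close>.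
\<close>
lemma slice_tail_cover:
  fixes U :: "nat \<Rightarrow> nat \<Rightarrow> (nat \<Rightarrow> real) set"
  assumes I: "finite I" and J: "J \<subseteq> I" and p: "p \<in> power_X I"
    and U: "\<And>n m. openin (power_top I) (U n m)" "\<And>n. slice I J p \<subseteq> (\<Union>m. U n m)"
  obtains a h where "a \<in> B"
    "\<And>x. x \<in> slice I J p \<Longrightarrow>
       \<forall>i\<in>I - J. x i \<in> core \<or> (\<exists>c\<in>B. x i = s c \<and> (c = a \<or> a \<in> underS |B| c)) \<Longrightarrow>
       \<forall>\<^sub>F n in sequentially. x \<in> (\<Union>m\<le>h n. U n m)"
proof -
  define L where "L m A = PiE I (\<lambda>i. if i \<in> J then {p i} else A)" for m :: nat and A
  have "\<forall>m n. \<exists>j. L m (\<Inter>g. K m g) \<subseteq> (\<Union>l\<le>j. U n l)"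
    unfolding L_def using slice_core_cover[OF I J p U] by blast
  then obtain j where j: "\<And>m n. L m (\<Inter>g. K m g) \<subseteq> (\<Union>l\<le>j m n. U n l)"
    by metis
  define W where "W m = (\<Inter>n\<in>{..m}. \<Union>l\<le>j m n. U n l)" for m
  \<comment> \<open>The compact boxes \<open>L m (K m g)\<close> decrease to a set inside the open
    \<open>W m\<close>, so one of them is already inside. This thickening lets points outside
    \<open>core\<close> be captured too.\<close>
  have "\<exists>g. L m (K m g) \<subseteq> W m" for m
  proof (rule nested_compactin_subset_openin[of "power_top I" "\<lambda>g. L m (K m g)" "W m"])
    show "Hausdorff_space (power_top I)"
      by (simp add: Hausdorff_space_product_topology)
    show "compactin (power_top I) (L m (K m g))" for g
      unfolding L_def compactin_PiE using compact_K by auto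
    show "decseq (\<lambda>g. L m (K m g))"
      unfolding decseq_def L_def using K_antimono by (intro allI impI PiE_mono) auto
    show "openin (power_top I) (W m)"
      unfolding W_def using U(1) by (intro openin_INT2) auto
    have "(\<Inter>g. L m (K m g)) \<subseteq> L m (\<Inter>g. K m g)"
    proof
      fix x assume "x \<in> (\<Inter>g. L m (K m g))"
      then have x: "x \<in> L m (K m g)" for g
        by blast
      have "x i \<in> (if i \<in> J then {p i} else \<Inter>g. K m g)" if "i \<in> I" for i
        using PiE_mem[OF x[unfolded L_def] that] by (cases "i \<in> J") auto
      moreover have "x \<in> extensional I"
        using x[of 0] by (simp add: L_def PiE_def)
      ultimately show "x \<in> L m (\<Inter>g. K m g)"
        unfolding L_def PiE_def by blast
    qed
    also have "L m (\<Inter>g. K m g) \<subseteq> W m"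
      unfolding W_def by (intro INT_greatest j)
    finally show "(\<Inter>g. L m (K m g)) \<subseteq> W m" .
  qed blast
  then obtain g where g: "\<And>m. L m (K m (g m)) \<subseteq> W m"
    by metis
  obtain a where a: "a \<in> B" "\<not> (\<forall>\<^sub>F m in sequentially. escape (s a) m \<le> g m)"
    using s_unbounded by blast
  define nxt where "nxt n = (LEAST m. n \<le> m \<and> g m < escape (s a) m)" for n
  have nxt: "n \<le> nxt n \<and> g (nxt n) < escape (s a) (nxt n)" for n
    unfolding nxt_def
  proof (rule LeastI_ex)
    show "\<exists>m. n \<le> m \<and> g m < escape (s a) m"
      using a(2) by (auto simp: eventually_sequentially not_le)
  qed
  have tail: "\<forall>\<^sub>F n in sequentially. x \<in> (\<Union>m\<le>j (nxt n) n. U n m)"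
    if x: "x \<in> slice I J p"
      and t: "\<forall>i\<in>I - J. x i \<in> core \<or> (\<exists>c\<in>B. x i = s c \<and> (c = a \<or> a \<in> underS |B| c))" for x
  proof -
    \<comment> \<open>A core coordinate lies in \<open>K m g\<close> for all \<open>g\<close> once
      \<open>m\<close> is large. A scale coordinate eventually escapes no earlier than
      \<open>s a\<close>, hence is still in \<open>K m (g m)\<close> at these
      \<open>m\<close>.\<close>
    have "\<forall>\<^sub>F m in sequentially. g m < escape (s a) m \<longrightarrow> x i \<in> K m (g m)" if i: "i \<in> I - J" for i
    proof (cases "x i \<in> core")
      case True
      then obtain m0 where m0: "\<And>g. x i \<in> K m0 g"
        by (auto simp: core_def)
      show ?thesis
        using eventually_ge_at_top[of m0]
      proof eventually_elim
        case (elim m)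
        show ?case
          using K_mono[OF elim] m0 by blast
      qed
    next
      case False
      then obtain c where c: "c \<in> B" "x i = s c" "c = a \<or> a \<in> underS |B| c"
        using t i by blast
      have "\<forall>\<^sub>F m in sequentially. escape (s a) m \<le> escape (s c) m"
        using c(3) s_increasing[OF c(1)] by auto
      then show ?thesis
        by eventually_elim (use mem_K_iff[OF False] c(2) in auto)
    qed
    then have "\<forall>\<^sub>F m in sequentially. \<forall>i\<in>I - J. g m < escape (s a) m \<longrightarrow> x i \<in> K m (g m)"
      using I by (intro eventually_ball_finite) auto
    then obtain N where N: "\<And>m i. N \<le> m \<Longrightarrow> i \<in> I - J \<Longrightarrow> g m < escape (s a) m \<Longrightarrow> x i \<in> K m (g m)"
      by (auto simp: eventually_sequentially)
    have "x \<in> (\<Union>m\<le>j (nxt n) n. U n m)" if n: "N \<le> n" for n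
    proof -
      have "x i \<in> K (nxt n) (g (nxt n))" if "i \<in> I - J" for i
        using N[OF _ that] nxt[of n] n by simp
      moreover have "x \<in> extensional I" "\<And>i. i \<in> J \<Longrightarrow> x i = p i"
        using x by (auto simp: slice_def PiE_def)
      ultimately have "x \<in> L (nxt n) (K (nxt n) (g (nxt n)))"
        by (auto simp: L_def PiE_def)
      then have "x \<in> W (nxt n)"
        using g by blast
      then show ?thesis
        unfolding W_def using nxt[of n] by blast
    qed
    then show ?thesis
      unfolding eventually_sequentially by blast
  qed
  show thesis
    by (rule that[OF a(1) tail])
qed

text \<open>
  A point not treated by \<open>slice_tail_cover\<close> has a further coordinate \<open>s c\<close> with \<open>c\<close> before \<open>a\<close>, and
  there are fewer than \<open>\<bb>\<close> slices fixing such a coordinate.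
\<close>
lemma hurewicz_on_slice:
  assumes I: "finite I"
  shows "J \<subseteq> I \<Longrightarrow> p \<in> power_X I \<Longrightarrow> hurewicz_on (power_top I) (slice I J p)"
proof (induction "card (I - J)" arbitrary: J p rule: less_induct)
  case less
  note J = less.prems(1) and p = less.prems(2)
  show ?case
    unfolding hurewicz_on_def
  proof (intro allI impI)
    fix U :: "nat \<Rightarrow> nat \<Rightarrow> (nat \<Rightarrow> real) set"
    assume "(\<forall>n m. openin (power_top I) (U n m)) \<and> (\<forall>n. slice I J p \<subseteq> (\<Union>m. U n m))"
    then have U: "\<And>n m. openin (power_top I) (U n m)" "\<And>n. slice I J p \<subseteq> (\<Union>m. U n m)"
      by auto
    obtain a h0 where a: "a \<in> B" and h0: "\<And>x. x \<in> slice I J p \<Longrightarrow>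
       \<forall>i\<in>I - J. x i \<in> core \<or> (\<exists>c\<in>B. x i = s c \<and> (c = a \<or> a \<in> underS |B| c)) \<Longrightarrow>
       \<forall>\<^sub>F n in sequentially. x \<in> (\<Union>m\<le>h0 n. U n m)"
      by (rule slice_tail_cover[where U = U, OF I J p U]) blast
    have "\<exists>h. \<forall>x\<in>slice I (insert i J) (p(i := s c)). \<forall>\<^sub>F n in sequentially. x \<in> (\<Union>m\<le>h n. U n m)"
      if i: "i \<in> I - J" and c: "c \<in> B" for i c
    proof -
      have "I - insert i J \<subset> I - J"
        using i by blast
      then have "card (I - insert i J) < card (I - J)"
        using I by (intro psubset_card_mono) auto
      moreover have "p(i := s c) \<in> power_X I"
        using p i c by (auto simp: PiE_iff X_def extensional_def)
      ultimately have hur: "hurewicz_on (power_top I) (slice I (insert i J) (p(i := s c)))"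
        using J i by (intro less.hyps) auto
      have "slice I (insert i J) (p(i := s c)) \<subseteq> slice I J p"
        using i by (auto simp: slice_def)
      then have "\<And>n. slice I (insert i J) (p(i := s c)) \<subseteq> (\<Union>m. U n m)"
        using U(2) by blast
      then show ?thesis
        using hur[unfolded hurewicz_on_def, rule_format, of U] U(1) by blast
    qed
    then have "\<forall>i\<in>I - J. \<forall>c\<in>B. \<exists>h. \<forall>x\<in>slice I (insert i J) (p(i := s c)).
        \<forall>\<^sub>F n in sequentially. x \<in> (\<Union>m\<le>h n. U n m)"
      by blast
    then obtain h where h: "\<forall>i\<in>I - J. \<forall>c\<in>B. \<forall>x\<in>slice I (insert i J) (p(i := s c)).
        \<forall>\<^sub>F n in sequentially. x \<in> (\<Union>m\<le>h i c n. U n m)"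
      unfolding bchoice_iff by blast
    have "\<exists>g. \<forall>c\<in>underS |B| a. \<forall>\<^sub>F n in sequentially. h i c n \<le> g n" for i
      by (rule initial_bounded[OF a])
    then obtain g where g: "\<And>i c. c \<in> underS |B| a \<Longrightarrow> \<forall>\<^sub>F n in sequentially. h i c n \<le> g i n"
      by metis
    \<comment> \<open>For each free coordinate \<open>i\<close>, \<open>g i\<close> bounds all
      \<open>h i c\<close> with \<open>c\<close> before \<open>a\<close>. As \<open>I\<close> is
      finite, one sum serves all coordinates together with the tail selection
      \<open>h0\<close>.\<close>
    define H where "H n = h0 n + (\<Sum>i\<in>I - J. g i n)" for n
    have "\<forall>\<^sub>F n in sequentially. x \<in> (\<Union>m\<le>H n. U n m)" if x: "x \<in> slice I J p" for x
    proof (cases "\<forall>i\<in>I - J. x i \<in> core \<or> (\<exists>c\<in>B. x i = s c \<and> (c = a \<or> a \<in> underS |B| c))")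
      case True
      then have "\<forall>\<^sub>F n in sequentially. x \<in> (\<Union>m\<le>h0 n. U n m)"
        by (intro h0 x)
      then show ?thesis
        by (rule eventually_mono) (force simp: H_def)
    next
      case False
      then obtain i where i: "i \<in> I - J" "x i \<notin> core"
        and nc: "\<And>c. c \<in> B \<Longrightarrow> x i = s c \<Longrightarrow> c \<noteq> a \<and> a \<notin> underS |B| c"
        by blast
      have "x i \<in> X"
        using x i by (auto simp: slice_def)
      then obtain c where c: "c \<in> B" "x i = s c"
        using i(2) by (auto simp: X_def)
      have ca: "c \<in> underS |B| a"
        using nc[OF c] B_cases[OF c(1) a] by blast
      have "x \<in> slice I (insert i J) (p(i := s c))"
        using x c(2) by (auto simp: slice_def)
      then have "\<forall>\<^sub>F n in sequentially. x \<in> (\<Union>m\<le>h i c n. U n m)"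
        using h i(1) c(1) by blast
      then show ?thesis
        using g[OF ca, of i]
      proof eventually_elim
        case (elim n)
        have "g i n \<le> (\<Sum>i\<in>I - J. g i n)"
          using I i(1) by (intro member_le_sum) auto
        then have "h i c n \<le> H n"
          using elim(2) by (simp add: H_def)
        moreover obtain m where "m \<le> h i c n" "x \<in> U n m"
          using elim(1) by blast
        ultimately show ?case
          by (intro UN_I[of m]) auto
      qed
    qed
    then show "\<exists>h. \<forall>x\<in>slice I J p. \<forall>\<^sub>F n in sequentially. x \<in> (\<Union>m\<le>h n. U n m)"
      by blast
  qed
qed

section \<open>Finite powers of the space and the conclusion\<close>

lemma uncountable_X: "uncountable X"
proof
  assume "countable X"
  then have "countable (s ` B)"
    by (rule countable_subset[rotated]) (simp add: X_def)
  then show False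
    using uncountable_scale by contradiction
qed

lemma Hurewicz_power_X:
  fixes I :: "nat set"
  assumes "finite I"
  shows "Hurewicz_space (product_topology (\<lambda>_. subtopology euclideanreal X) I)"
proof -
  obtain y where "y \<in> X"
    using uncountable_X by (metis countable_empty equals0I)
  \<comment> \<open>A base point is needed only to invoke the slice result with no frozen
    coordinates, where the slice is the whole power.\<close>
  then have "restrict (\<lambda>_. y) I \<in> power_X I"
    by simp
  from hurewicz_on_slice[OF assms empty_subsetI this]
  have "hurewicz_on (power_top I) (power_X I)"
    by (simp add: slice_def)
  moreover have "power_X I \<subseteq> topspace (power_top I)"
    by (auto simp: PiE_iff)
  moreover have "Lindelof_space (subtopology (power_top I) (power_X I))"
    by (rule Lindelof_subspace_power_real) (auto simp: PiE_iff)
  ultimately have "Hurewicz_space (subtopology (power_top I) (power_X I))"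
    by (rule Hurewicz_space_if_hurewicz_on)
  then show ?thesis
    by (simp add: subtopology_product_topology)
qed

end

theorem theorem2p5:
  shows "\<exists>X :: real set.
           (\<forall>k::nat. k \<ge> 1 \<longrightarrow>
              Hurewicz_space (product_topology (\<lambda>_. subtopology euclideanreal X) {..<k}))
         \<and> \<not> productively_Lindelof (subtopology euclideanreal X) TYPE(real)
         \<and> \<not> Alster_space (subtopology euclideanreal X)"
proof -
  obtain B s where "cantor_scale (\<lambda>m g. cantor_real ` few_bits m g) (range cantor_real) B s"
    using cantor_grid.exists_cantor_scale[OF cantor_grid_cantor_real] by blast
  then interpret cantor_scale "\<lambda>m g. cantor_real ` few_bits m g" "range cantor_real" B s .
  show ?thesis
    using Hurewicz_power_X[OF finite_lessThan]
      not_productively_Lindelof[OF countable_closed_subset_X uncountable_X]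
      not_Alster_space[OF countable_closed_subset_X uncountable_X]
    by blast
qed

end
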